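(* Let $(G,c)$ be a resistance network with vertex set $V$. If $u\in\mathcal H_{\mathcal E}$ and $v\in\mathcal M$, then $$\langle u,v\rangle_{\mathcal E}=\sum_{x\in V}\overline{u(x)}\,(\Delta v)(x)+\sum_{\mathrm{bd}\,G}\overline{u}\,\frac{\partial v}{\partial n}.$$
   Context: A resistance network $(G,c)$ is a connected graph with vertex set $V$ and a conductance function $c_{xy}=c_{yx}\in[0,\infty)$ with $c_{xx}=0$, where $x\sim y$ (adjacency) iff $c_{xy}>0$, and $c(x):=\sum_{y\sim x}c_{xy}<\infty$ for every $x\in V$. Fix a reference vertex $o\in V$. The Laplacian is $(\Delta v)(x)=\sum_{y\sim x}c_{xy}(v(x)-v(y))$. The energy form is $\mathcal E(u,v)=\frac12\sum_{x,y\in V}c_{xy}\overline{(u(x)-u(y))}(v(x)-v(y))$, and $\mathrm{dom}\,\mathcal E$ is the set of functions $u$ on $V$ with $\mathcal E(u,u)<\infty$. The energy Hilbert space $\mathcal H_{\mathcal E}$ is the completion of $\mathrm{dom}\,\mathcal E$ modulo constant functions, with inner product $\langle u,v\rangle_{\mathcal E}=\mathcal E(u,v)$; its elements are classes of functions on $V$ modulo constants. When values of $u$ are written, any representative may be used (the same one in both sums). For $x\in V$, $v_x\in\mathcal H_{\mathcal E}$ is the unique element with $\langle v_x,u\rangle_{\mathcal E}=u(x)-u(o)$ for all $u\in\mathcal H_{\mathcal E}$. $\mathrm{Fin}$ is the closure in $\mathcal H_{\mathcal E}$ of $\mathrm{span}\{\delta_x\}_{x\in V}$ (Dirac masses), and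 $f_x$ is the orthogonal projection of $v_x$ to $\mathrm{Fin}$. A monopole at $x$ is an element $w\in\mathcal H_{\mathcal E}$ with $\Delta w=\delta_x$ pointwise. If monopoles exist, $w_o$ denotes the unique monopole at $o$ of minimal energy, and $w_x^{v}:=v_x+w_o$, $w_x^{f}:=f_x+w_o$. The space $\mathcal M$ is the set of finite linear combinations $\mathcal M=\mathrm{span}\{v_x\}_{x\in V}+\mathrm{span}\{w_x^{v},w_x^{f}\}_{x\in V}$, with $\mathcal M=\mathrm{span}\{v_x\}_{x\in V}$ if there are no monopoles in $\mathcal H_{\mathcal E}$. An exhaustion of $G$ is an increasing sequence of finite connected subgraphs $G_k$ with $\bigcup_kG_k=G$. The notation $\sum_{x\in V}$ means $\lim_{k\to\infty}\sum_{x\in G_k}$, used whenever the limit is independent of the choice of exhaustion. For a subgraph $H$, $\mathrm{bd}\,H=\{x\in H:\exists y\notin H,\ y\sim x\}$, and for $x\in\mathrm{bd}\,H$ the normal derivative is $\frac{\partial v}{\partial n}(x)=\sum_{y\in H}c_{xy}(v(x)-v(y))$. The boundary sum is $\sum_{\mathrm{bd}\,G}\overline u\frac{\partial v}{\partial n}:=\lim_{k\to\infty}\sum_{x\in\mathrm{bd}\,G_k}\overline{u(x)}\frac{\partial v}{\partial n}(x)$ (normal derivatives with respect to $G_k$), whenever the limit is independent of the choice of exhaustion.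
   Formalization: Proved for locally finite networks (every vertex has finitely many neighbours); if some vertex has infinite degree the identity fails for some u and v, because that vertex lies in every bd G_k and is counted in both sums. *)

theory Defs
  imports "HOL-Analysis.Analysis"
begin

section \<open>Resistance networks\<close>

text \<open>The vertex set is the type \<open>'v\<close>; the graph is determined by the conductance function.\<close>

definition adj :: "('v \<Rightarrow> 'v \<Rightarrow> real) \<Rightarrow> 'v \<Rightarrow> 'v \<Rightarrow> bool" where
  "adj c x y \<longleftrightarrow> 0 < c x y"

text \<open>Paths inside \<open>H\<close>, i.e. connectedness of the induced subgraph.\<close>

definition connected_in :: "('v \<Rightarrow> 'v \<Rightarrow> real) \<Rightarrow> 'v set \<Rightarrow> bool" where
  "connected_in c H \<longleftrightarrow>
     (\<forall>x\<in>H. \<forall>y\<in>H. (x, y) \<in> {(a, b). a \<in> H \<and> b \<in> H \<and> adj c a b}\<^sup>*)"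

locale resistance_network =
  fixes c :: "'v \<Rightarrow> 'v \<Rightarrow> real"
  assumes c_nonneg: "0 \<le> c x y"
    and c_sym: "c x y = c y x"
    and c_loopless: "c x x = 0"
    and c_summable: "c x summable_on {y. adj c x y}"
    and connected: "connected_in c UNIV"

text \<open>
  A vertex of infinite degree lies in the boundary of every finite subgraph containing it, so its
  contribution \<open>cnj (u x) * laplacian c v x\<close> would be counted both in the vertex sum and in the
  boundary sum of the Gauss-Green identity. Finiteness of \<open>c(x)\<close> does not exclude such vertices.
\<close>

definition locally_finite :: "('v \<Rightarrow> 'v \<Rightarrow> real) \<Rightarrow> bool" where
  "locally_finite c \<longleftrightarrow> (\<forall>x. finite {y. adj c x y})"

definition laplacian :: "('v \<Rightarrow> 'v \<Rightarrow> real) \<Rightarrow> ('v \<Rightarrow> complex) \<Rightarrow> 'v \<Rightarrow> complex" where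
  "laplacian c v x = (\<Sum>\<^sub>\<infinity>y\<in>{y. adj c x y}. of_real (c x y) * (v x - v y))"

section \<open>The energy space\<close>

definition energy :: "('v \<Rightarrow> 'v \<Rightarrow> real) \<Rightarrow> ('v \<Rightarrow> complex) \<Rightarrow> ('v \<Rightarrow> complex) \<Rightarrow> complex" where
  "energy c u v =
     1/2 * (\<Sum>\<^sub>\<infinity>(x, y)\<in>UNIV. of_real (c x y) * cnj (u x - u y) * (v x - v y))"

definition energy_norm :: "('v \<Rightarrow> 'v \<Rightarrow> real) \<Rightarrow> ('v \<Rightarrow> complex) \<Rightarrow> real" where
  "energy_norm c u = sqrt (Re (energy c u u))"

text \<open>
  The functions of finite energy. An element of the energy Hilbert space is a class of such
  functions modulo constants, and it is represented here by any function in its class: everything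
  below is stated for representatives and is invariant under adding constants. No further
  completion is needed, since the functions of finite energy are already complete
  (\<open>energy_space_complete\<close> below).
\<close>

definition energy_space :: "('v \<Rightarrow> 'v \<Rightarrow> real) \<Rightarrow> ('v \<Rightarrow> complex) set" where
  "energy_space c =
     {u. (\<lambda>(x, y). c x y * (cmod (u x - u y))\<^sup>2) summable_on UNIV}"

definition cspan :: "('v \<Rightarrow> complex) set \<Rightarrow> ('v \<Rightarrow> complex) set" where
  "cspan S = {\<lambda>x. \<Sum>g\<in>F. a g * g x | F a. finite F \<and> F \<subseteq> S}"

definition dirac :: "'v \<Rightarrow> 'v \<Rightarrow> complex" where
  "dirac x y = (if y = x then 1 else 0)"

text \<open>
  The elements \<open>v\<^sub>x\<close>, \<open>f\<^sub>x\<close>, \<open>w\<^sub>o\<close> are unique only modulo constants, so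
  they are rendered as predicates on representatives; the reference vertex \<open>o\<close> is written
  \<open>b\<close>, because \<open>o\<close> denotes composition.
\<close>

definition is_kernel :: "('v \<Rightarrow> 'v \<Rightarrow> real) \<Rightarrow> 'v \<Rightarrow> 'v \<Rightarrow> ('v \<Rightarrow> complex) \<Rightarrow> bool" where
  "is_kernel c b x v \<longleftrightarrow>
     v \<in> energy_space c \<and> (\<forall>u\<in>energy_space c. energy c v u = u x - u b)"

definition Fin :: "('v \<Rightarrow> 'v \<Rightarrow> real) \<Rightarrow> ('v \<Rightarrow> complex) set" where
  "Fin c = {u \<in> energy_space c.
     \<forall>\<epsilon>>0. \<exists>s\<in>cspan (range dirac). energy_norm c (\<lambda>x. u x - s x) < \<epsilon>}"

definition is_projection ::
    "('v \<Rightarrow> 'v \<Rightarrow> real) \<Rightarrow> ('v \<Rightarrow> complex) set \<Rightarrow> ('v \<Rightarrow> complex) \<Rightarrow> ('v \<Rightarrow> complex) \<Rightarrow> bool" where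
  "is_projection c S v f \<longleftrightarrow> f \<in> S \<and> (\<forall>g\<in>S. energy c g (\<lambda>x. v x - f x) = 0)"

definition is_fin_kernel :: "('v \<Rightarrow> 'v \<Rightarrow> real) \<Rightarrow> 'v \<Rightarrow> 'v \<Rightarrow> ('v \<Rightarrow> complex) \<Rightarrow> bool" where
  "is_fin_kernel c b x f \<longleftrightarrow> (\<exists>v. is_kernel c b x v \<and> is_projection c (Fin c) v f)"

definition is_monopole :: "('v \<Rightarrow> 'v \<Rightarrow> real) \<Rightarrow> 'v \<Rightarrow> ('v \<Rightarrow> complex) \<Rightarrow> bool" where
  "is_monopole c x w \<longleftrightarrow> w \<in> energy_space c \<and> laplacian c w = dirac x"

definition is_minimal_monopole :: "('v \<Rightarrow> 'v \<Rightarrow> real) \<Rightarrow> 'v \<Rightarrow> ('v \<Rightarrow> complex) \<Rightarrow> bool" where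
  "is_minimal_monopole c x w \<longleftrightarrow>
     is_monopole c x w \<and> (\<forall>w'. is_monopole c x w' \<longrightarrow> energy_norm c w \<le> energy_norm c w')"

text \<open>All representatives of the \<open>v\<^sub>x\<close>, and of the \<open>w\<^sub>x\<^sup>v\<close> and \<open>w\<^sub>x\<^sup>f\<close>.\<close>

definition kernels :: "('v \<Rightarrow> 'v \<Rightarrow> real) \<Rightarrow> 'v \<Rightarrow> ('v \<Rightarrow> complex) set" where
  "kernels c b = {v. \<exists>x. is_kernel c b x v}"

definition monopole_kernels :: "('v \<Rightarrow> 'v \<Rightarrow> real) \<Rightarrow> 'v \<Rightarrow> ('v \<Rightarrow> complex) set" where
  "monopole_kernels c b =
     {\<lambda>y. v y + w y | v w. (\<exists>x. is_kernel c b x v) \<and> is_minimal_monopole c b w} \<union>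
     {\<lambda>y. f y + w y | f w. (\<exists>x. is_fin_kernel c b x f) \<and> is_minimal_monopole c b w}"

definition \<M> :: "('v \<Rightarrow> 'v \<Rightarrow> real) \<Rightarrow> 'v \<Rightarrow> ('v \<Rightarrow> complex) set" where
  "\<M> c b =
     (if \<exists>x w. is_monopole c x w
      then {\<lambda>y. p y + q y | p q. p \<in> cspan (kernels c b) \<and> q \<in> cspan (monopole_kernels c b)}
      else cspan (kernels c b))"

section \<open>Exhaustions and boundary sums\<close>

text \<open>
  Subgraphs enter only through their vertex sets. The vertex sets of an exhaustion by
  arbitrary connected subgraphs are those of an exhaustion by induced ones.
\<close>

definition exhaustion :: "('v \<Rightarrow> 'v \<Rightarrow> real) \<Rightarrow> (nat \<Rightarrow> 'v set) \<Rightarrow> bool" where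
  "exhaustion c G \<longleftrightarrow>
     (\<forall>k. finite (G k) \<and> connected_in c (G k) \<and> G k \<subseteq> G (Suc k)) \<and> (\<Union>k. G k) = UNIV"

text \<open>\<open>T H\<close> tends to \<open>L\<close> as \<open>H\<close> exhausts the network, independently of the exhaustion.\<close>

definition has_exhaustion_limit ::
    "('v \<Rightarrow> 'v \<Rightarrow> real) \<Rightarrow> ('v set \<Rightarrow> complex) \<Rightarrow> complex \<Rightarrow> bool" where
  "has_exhaustion_limit c T L \<longleftrightarrow>
     (\<exists>G. exhaustion c G) \<and> (\<forall>G. exhaustion c G \<longrightarrow> (\<lambda>k. T (G k)) \<longlonglongrightarrow> L)"

definition bd :: "('v \<Rightarrow> 'v \<Rightarrow> real) \<Rightarrow> 'v set \<Rightarrow> 'v set" where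
  "bd c H = {x\<in>H. \<exists>y. y \<notin> H \<and> adj c x y}"

definition normal_derivative ::
    "('v \<Rightarrow> 'v \<Rightarrow> real) \<Rightarrow> 'v set \<Rightarrow> ('v \<Rightarrow> complex) \<Rightarrow> 'v \<Rightarrow> complex" where
  "normal_derivative c H v x = (\<Sum>y\<in>H. of_real (c x y) * (v x - v y))"

definition has_vertex_sum ::
    "('v \<Rightarrow> 'v \<Rightarrow> real) \<Rightarrow> ('v \<Rightarrow> complex) \<Rightarrow> complex \<Rightarrow> bool" where
  "has_vertex_sum c h L \<longleftrightarrow> has_exhaustion_limit c (\<lambda>H. \<Sum>x\<in>H. h x) L"

definition has_boundary_sum ::
    "('v \<Rightarrow> 'v \<Rightarrow> real) \<Rightarrow> ('v \<Rightarrow> complex) \<Rightarrow> ('v \<Rightarrow> complex) \<Rightarrow> complex \<Rightarrow> bool" where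
  "has_boundary_sum c u v L \<longleftrightarrow>
     has_exhaustion_limit c (\<lambda>H. \<Sum>x\<in>bd c H. cnj (u x) * normal_derivative c H v x) L"

section \<open>Completeness of the energy space\<close>

context resistance_network
begin

lemma energy_self:
  "energy c u u = of_real (1/2 * (\<Sum>\<^sub>\<infinity>(x, y)\<in>UNIV. c x y * (cmod (u x - u y))\<^sup>2))"
proof -
  have "of_real (c x y) * cnj (u x - u y) * (u x - u y)
      = (of_real (c x y * (cmod (u x - u y))\<^sup>2) :: complex)" for x y
    unfolding of_real_mult complex_norm_square by (simp only: mult.assoc mult.commute[of "cnj _"])
  then have eq: "(\<lambda>(x, y). of_real (c x y) * cnj (u x - u y) * (u x - u y))
      = (\<lambda>p. of_real ((\<lambda>(x, y). c x y * (cmod (u x - u y))\<^sup>2) p) :: complex)"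
    by (simp add: fun_eq_iff)
  have "(\<Sum>\<^sub>\<infinity>p\<in>A. of_real (h p) :: complex) = of_real (\<Sum>\<^sub>\<infinity>p\<in>A. h p)"
    for h :: "'v \<times> 'v \<Rightarrow> real" and A
    using summable_on_Re[of "\<lambda>p. of_real (h p)" A]
    by (intro infsum_bounded_linear_strong bounded_linear_of_real) (auto intro: summable_on_of_real)
  then show ?thesis
    unfolding energy_def eq by simp
qed

lemma energy_norm_sq:
  "2 * (energy_norm c u)\<^sup>2 = (\<Sum>\<^sub>\<infinity>(x, y)\<in>UNIV. c x y * (cmod (u x - u y))\<^sup>2)"
proof -
  have "0 \<le> (\<Sum>\<^sub>\<infinity>(x, y)\<in>UNIV. c x y * (cmod (u x - u y))\<^sup>2)"
    by (rule infsum_nonneg) (auto simp: c_nonneg)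
  then show ?thesis
    by (simp add: energy_norm_def energy_self)
qed

lemma energy_norm_nonneg: "0 \<le> energy_norm c u"
proof -
  have "0 \<le> (\<Sum>\<^sub>\<infinity>(x, y)\<in>UNIV. c x y * (cmod (u x - u y))\<^sup>2)"
    by (rule infsum_nonneg) (auto simp: c_nonneg)
  then show ?thesis
    by (simp add: energy_norm_def energy_self)
qed

lemma energy_space_diff:
  assumes u: "u \<in> energy_space c" and v: "v \<in> energy_space c"
  shows "(\<lambda>x. u x - v x) \<in> energy_space c"
proof -
  let ?q = "\<lambda>u (x, y). c x y * (cmod (u x - u y :: complex))\<^sup>2"
  have s: "(\<lambda>p. 2 * ?q u p + 2 * ?q v p) summable_on UNIV"
    using u v by (intro summable_on_add summable_on_cmult_right) (auto simp: energy_space_def)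
  have "(cmod (a - b))\<^sup>2 \<le> 2 * (cmod a)\<^sup>2 + 2 * (cmod b)\<^sup>2" for a b :: complex
  proof -
    have "(cmod (a - b))\<^sup>2 + (cmod (a + b))\<^sup>2 = 2 * (cmod a)\<^sup>2 + 2 * (cmod b)\<^sup>2"
      unfolding cmod_power2 by (simp add: power2_eq_square algebra_simps)
    then show ?thesis by (smt (verit) zero_le_power2)
  qed
  note ineq = this
  have "?q (\<lambda>x. u x - v x) (x, y) \<le> 2 * ?q u (x, y) + 2 * ?q v (x, y)" for x y
    using mult_left_mono[OF ineq[of "u x - u y" "v x - v y"] c_nonneg[of x y]]
    by (simp add: algebra_simps)
  then have "?q (\<lambda>x. u x - v x) summable_on UNIV"
    by (intro summable_on_comparison_test[OF s]) (auto simp: c_nonneg)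
  then show ?thesis by (simp add: energy_space_def)
qed

lemma edge_le_energy:
  assumes u: "u \<in> energy_space c"
  shows "c x y * (cmod (u x - u y))\<^sup>2 \<le> 2 * (energy_norm c u)\<^sup>2"
proof -
  have "(\<Sum>(x, y)\<in>{(x, y)}. c x y * (cmod (u x - u y))\<^sup>2) \<le> 2 * (energy_norm c u)\<^sup>2"
    unfolding energy_norm_sq
    by (rule finite_sum_le_infsum) (use u in \<open>auto simp: energy_space_def c_nonneg\<close>)
  then show ?thesis by simp
qed

theorem energy_space_complete:
  assumes U: "\<And>n. U n \<in> energy_space c"
    and Cauchy: "\<And>\<epsilon>. 0 < \<epsilon> \<Longrightarrow> \<exists>N. \<forall>m\<ge>N. \<forall>n\<ge>N. energy_norm c (\<lambda>x. U m x - U n x) < \<epsilon>"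
  shows "\<exists>u\<in>energy_space c. (\<lambda>n. energy_norm c (\<lambda>x. U n x - u x)) \<longlonglongrightarrow> 0"
proof -
  have D: "(\<lambda>x. U m x - U n x) \<in> energy_space c" for m n
    by (rule energy_space_diff[OF U U])
  have edge: "convergent (\<lambda>n. U n x - U n y)" if "adj c x y" for x y
  proof -
    have cp: "c x y > 0" using that by (simp add: adj_def)
    have "\<exists>M. \<forall>m\<ge>M. \<forall>n\<ge>M. cmod ((U m x - U m y) - (U n x - U n y)) < e" if e: "e > 0" for e
    proof -
      define d where "d = e * sqrt (c x y / 2)"
      have d: "d > 0" "2 * d\<^sup>2 = c x y * e\<^sup>2"
        using e cp by (auto simp: d_def power_mult_distrib)
      obtain N where N: "\<And>m n. m \<ge> N \<Longrightarrow> n \<ge> N \<Longrightarrow> energy_norm c (\<lambda>x. U m x - U n x) < d"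
        using Cauchy[OF d(1)] by blast
      have "cmod ((U m x - U m y) - (U n x - U n y)) < e" if "m \<ge> N" "n \<ge> N" for m n
      proof -
        have "c x y * (cmod ((U m x - U n x) - (U m y - U n y)))\<^sup>2
            \<le> 2 * (energy_norm c (\<lambda>x. U m x - U n x))\<^sup>2"
          using edge_le_energy[OF D, of x y m n] by simp
        also have "\<dots> < 2 * d\<^sup>2"
          using N[OF that] energy_norm_nonneg by (simp add: power_strict_mono)
        also have "\<dots> = c x y * e\<^sup>2" by (rule d(2))
        finally have "(cmod ((U m x - U n x) - (U m y - U n y)))\<^sup>2 < e\<^sup>2"
          using cp by simp
        then have "cmod ((U m x - U n x) - (U m y - U n y)) < e"
          using e by (simp add: power_less_imp_less_base)
        then show ?thesis by (simp add: algebra_simps)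
      qed
      then show ?thesis by blast
    qed
    then have "Cauchy (\<lambda>n. U n x - U n y)" by (rule CauchyI)
    then show ?thesis by (rule Cauchy_convergent)
  qed
  have conv: "convergent (\<lambda>n. U n x - U n y)" for x y
  proof -
    have "(x, y) \<in> {(a, b). a \<in> UNIV \<and> b \<in> UNIV \<and> adj c a b}\<^sup>*"
      using connected by (simp add: connected_in_def)
    then show ?thesis
    proof (induction rule: rtrancl_induct)
      case base
      show ?case by (simp add: convergent_const)
    next
      case (step y z)
      then have "convergent (\<lambda>n. (U n x - U n y) + (U n y - U n z))"
        using edge[of y z] by (intro convergent_add) auto
      then show ?case by simp
    qed
  qed
  obtain b :: 'v where True by simp
  define u where "u x = lim (\<lambda>n. U n x - U n b)" for x
  have lim: "(\<lambda>n. U n x - U n b) \<longlonglongrightarrow> u x" for x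
    unfolding u_def using conv by (simp add: convergent_LIMSEQ_iff)
  have lim2: "(\<lambda>n. U n x - U n y) \<longlonglongrightarrow> u x - u y" for x y
    using tendsto_diff[OF lim[of x] lim[of y]] by simp
  have key: "(\<lambda>x. U m x - u x) \<in> energy_space c \<and> energy_norm c (\<lambda>x. U m x - u x) \<le> e"
    if e: "e > 0" and N: "\<And>n. n \<ge> N \<Longrightarrow> energy_norm c (\<lambda>x. U m x - U n x) < e" for m N e
  proof -
    let ?q = "\<lambda>u (x, y). c x y * (cmod (u x - u y :: complex))\<^sup>2"
    have fin: "sum (?q (\<lambda>x. U m x - u x)) F \<le> 2 * e\<^sup>2" if F: "finite F" for F
    proof (rule tendsto_upperbound)
      have "(\<lambda>n. \<Sum>(x, y)\<in>F. c x y * (cmod ((U m x - U m y) - (U n x - U n y)))\<^sup>2)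
          \<longlonglongrightarrow> (\<Sum>(x, y)\<in>F. c x y * (cmod ((U m x - U m y) - (u x - u y)))\<^sup>2)"
        unfolding case_prod_unfold by (intro tendsto_intros lim2)
      then show "(\<lambda>n. sum (?q (\<lambda>x. U m x - U n x)) F) \<longlonglongrightarrow> sum (?q (\<lambda>x. U m x - u x)) F"
        by (simp add: algebra_simps)
      show "\<forall>\<^sub>F n in sequentially. sum (?q (\<lambda>x. U m x - U n x)) F \<le> 2 * e\<^sup>2"
      proof (rule eventually_sequentiallyI)
        fix n assume "n \<ge> N"
        have "sum (?q (\<lambda>x. U m x - U n x)) F \<le> 2 * (energy_norm c (\<lambda>x. U m x - U n x))\<^sup>2"
          unfolding energy_norm_sq
          by (rule finite_sum_le_infsum) (use D F in \<open>auto simp: energy_space_def c_nonneg\<close>)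
        also have "\<dots> \<le> 2 * e\<^sup>2"
          using N[OF \<open>n \<ge> N\<close>] energy_norm_nonneg by (simp add: power_mono)
        finally show "sum (?q (\<lambda>x. U m x - U n x)) F \<le> 2 * e\<^sup>2" .
      qed
    qed simp
    have sm: "?q (\<lambda>x. U m x - u x) summable_on UNIV"
      by (rule nonneg_bounded_partial_sums_imp_summable_on[where C = "2 * e\<^sup>2"])
         (use fin in \<open>auto simp: c_nonneg eventually_finite_subsets_at_top\<close>)
    then have "2 * (energy_norm c (\<lambda>x. U m x - u x))\<^sup>2 \<le> 2 * e\<^sup>2"
      unfolding energy_norm_sq by (rule infsum_le_finite_sums) (use fin in auto)
    then have "energy_norm c (\<lambda>x. U m x - u x) \<le> e"
      using e by (auto intro: power2_le_imp_le[OF _ less_imp_le])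
    then show ?thesis using sm by (simp add: energy_space_def)
  qed
  have "\<exists>N. \<forall>m\<ge>N. (\<lambda>x. U m x - u x) \<in> energy_space c \<and> energy_norm c (\<lambda>x. U m x - u x) \<le> e"
    if "e > 0" for e
    using Cauchy[OF that] key[OF that] by meson
  note small = this
  obtain m where m: "(\<lambda>x. U m x - u x) \<in> energy_space c"
    using small[of 1] by auto
  have "u \<in> energy_space c"
    using energy_space_diff[OF U[of m] m] by simp
  moreover have "(\<lambda>n. energy_norm c (\<lambda>x. U n x - u x)) \<longlonglongrightarrow> 0"
  proof (rule LIMSEQ_I)
    fix e :: real assume "e > 0"
    then obtain N where "\<forall>m\<ge>N. energy_norm c (\<lambda>x. U m x - u x) \<le> e / 2"
      using small[of "e/2"] by auto
    with \<open>e > 0\<close> show "\<exists>N. \<forall>n\<ge>N. norm (energy_norm c (\<lambda>x. U n x - u x) - 0) < e"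
      using energy_norm_nonneg by (intro exI[of _ N]) fastforce
  qed
  ultimately show ?thesis by blast
qed

end

end

theory Submission
  imports Defs
begin

text \<open>
  Every element of \<open>\<M>\<close> has finite energy and a finitely supported Laplacian: testing against
  Dirac masses turns the reproducing property of \<open>v\<^sub>x\<close>, and the orthogonality
  \<open>v\<^sub>x - f\<^sub>x \<bottom> Fin\<close>, into pointwise formulas for the Laplacian. On a finite vertex set \<open>H\<close>,
  summation by parts writes the energy over \<open>H\<close> as the sum of \<open>cnj u\<close> times the normal derivative
  of \<open>v\<close> relative to \<open>H\<close>, which is the Laplacian at interior vertices. Along an exhaustion the
  energies over \<open>G\<^sub>k\<close> converge by absolute summability and the interior sums are eventually
  constant, so the boundary sums converge to the difference.
\<close>

section \<open>Exhaustions and limits along them\<close>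

lemma exhaustion_finite: "exhaustion c G \<Longrightarrow> finite (G k)"
  by (simp add: exhaustion_def)

lemma exhaustion_eventually_superset:
  assumes G: "exhaustion c G" and X: "finite X"
  shows "\<forall>\<^sub>F k in sequentially. X \<subseteq> G k"
proof -
  have mono: "G m \<subseteq> G n" if "m \<le> n" for m n
    by (rule lift_Suc_mono_le[of G]) (use G that in \<open>auto simp: exhaustion_def\<close>)
  have "\<forall>\<^sub>F k in sequentially. x \<in> G k" for x
  proof -
    have "x \<in> (\<Union>k. G k)"
      using G by (simp add: exhaustion_def)
    then obtain n where "x \<in> G n" by blast
    then show ?thesis
      using mono by (intro eventually_sequentiallyI[of n]) blast
  qed
  then have "\<forall>\<^sub>F k in sequentially. \<forall>x\<in>X. x \<in> G k"
    using X by (simp add: eventually_ball_finite)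
  then show ?thesis by (simp add: subset_eq)
qed

text \<open>The squares \<open>G k \<times> G k\<close> are cofinal among the finite sets of pairs:
  a finite \<open>X\<close> lies in the square as soon as \<open>G k\<close> contains both
  projections of \<open>X\<close>. The unconditional sum is therefore reached along every
  exhaustion, which makes the limit independent of the choice.\<close>

lemma exhaustion_tendsto_infsum:
  fixes f :: "'v \<times> 'v \<Rightarrow> complex"
  assumes G: "exhaustion c G" and f: "f summable_on UNIV"
  shows "(\<lambda>k. sum f (G k \<times> G k)) \<longlonglongrightarrow> infsum f UNIV"
proof -
  have "filterlim (\<lambda>k. G k \<times> G k) (finite_subsets_at_top UNIV) sequentially"
    unfolding filterlim_finite_subsets_at_top
  proof safe
    fix X :: "('v \<times> 'v) set" assume X: "finite X"
    have "\<forall>\<^sub>F k in sequentially. fst ` X \<union> snd ` X \<subseteq> G k"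
      by (rule exhaustion_eventually_superset[OF G]) (use X in simp)
    then show "\<forall>\<^sub>F k in sequentially. finite (G k \<times> G k) \<and> X \<subseteq> G k \<times> G k \<and> G k \<times> G k \<subseteq> UNIV"
      by eventually_elim (use exhaustion_finite[OF G] in force)
  qed
  then show ?thesis
    by (rule filterlim_compose[OF infsum_tendsto[OF f]])
qed

text \<open>Peeling off one generator at a time reduces membership of a span in a linear space to
  closure under zero, sums and multiples.\<close>

lemma cspan_induct [consumes 1, case_names zero step]:
  assumes p: "p \<in> cspan S"
    and zero: "P (\<lambda>x. 0)"
    and step: "\<And>g h a. g \<in> S \<Longrightarrow> P h \<Longrightarrow> P (\<lambda>x. a * g x + h x)"
  shows "P p"
proof -
  obtain F a where F: "finite F" "F \<subseteq> S" and p_eq: "p = (\<lambda>x. \<Sum>g\<in>F. a g * g x)"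
    using p by (auto simp: cspan_def)
  from F have "P (\<lambda>x. \<Sum>g\<in>F. a g * g x)"
  proof (induction F)
    case empty
    show ?case using zero by simp
  next
    case (insert g F)
    then show ?case
      using step[of g "\<lambda>x. \<Sum>g\<in>F. a g * g x" "a g"] by simp
  qed
  then show ?thesis by (simp add: p_eq)
qed

lemma cspan_base: "g \<in> S \<Longrightarrow> g \<in> cspan S"
  unfolding cspan_def by (rule CollectI) (rule exI[of _ "{g}"], rule exI[of _ "\<lambda>_. 1"], simp)

section \<open>Linearity of the energy space and the energy form\<close>

context resistance_network
begin

lemma energy_space_zero: "(\<lambda>x. 0) \<in> energy_space c"
  by (simp add: energy_space_def case_prod_unfold)

lemma energy_space_scale:
  assumes "u \<in> energy_space c"
  shows "(\<lambda>x. a * u x) \<in> energy_space c"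
proof -
  have "(\<lambda>(x, y). c x y * (cmod (a * u x - a * u y))\<^sup>2)
      = (\<lambda>p. (cmod a)\<^sup>2 * (\<lambda>(x, y). c x y * (cmod (u x - u y))\<^sup>2) p)"
    by (auto simp: fun_eq_iff norm_mult power_mult_distrib simp flip: right_diff_distrib)
  then show ?thesis
    using assms unfolding energy_space_def by (simp add: summable_on_cmult_right)
qed

lemma energy_space_add:
  assumes "u \<in> energy_space c" "v \<in> energy_space c"
  shows "(\<lambda>x. u x + v x) \<in> energy_space c"
  using energy_space_diff[OF assms(1) energy_space_scale[OF assms(2), of "-1"]] by simp

text \<open>Absolute convergence: on each edge \<open>r * s \<le> r\<^sup>2 + s\<^sup>2\<close>,
  weighted by the conductance, bounds the mixed term by the two energy densities.\<close>

lemma energy_summable: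
  assumes u: "u \<in> energy_space c" and v: "v \<in> energy_space c"
  shows "(\<lambda>(x, y). of_real (c x y) * cnj (u x - u y) * (v x - v y)) summable_on UNIV"
proof (rule abs_summable_summable)
  let ?f = "\<lambda>(x, y). of_real (c x y) * cnj (u x - u y) * (v x - v y)"
  let ?q = "\<lambda>u (x, y). c x y * (cmod (u x - u y :: complex))\<^sup>2"
  have s: "(\<lambda>p. ?q u p + ?q v p) summable_on UNIV"
    using u v by (intro summable_on_add) (auto simp: energy_space_def)
  have ab: "r * s \<le> r\<^sup>2 + s\<^sup>2" if "0 \<le> r" "0 \<le> s" for r s :: real
    using that sum_squares_bound[of r s] mult_nonneg_nonneg[OF that] by linarith
  have "norm (of_real (c x y) * cnj (u x - u y) * (v x - v y)) \<le> ?q u (x, y) + ?q v (x, y)" for x y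
    using mult_left_mono[OF ab[of "cmod (u x - u y)" "cmod (v x - v y)"] c_nonneg[of x y]]
      c_nonneg[of x y]
    by (simp add: norm_mult distrib_left mult.assoc del: complex_cnj_diff)
  then show "(\<lambda>p. norm (?f p)) summable_on UNIV"
    by (intro summable_on_comparison_test[OF s]) auto
qed

lemma energy_cnj: "energy c v u = cnj (energy c u v)"
proof -
  have "cnj (energy c u v)
      = 1/2 * (\<Sum>\<^sub>\<infinity>p\<in>UNIV. cnj ((\<lambda>(x, y). of_real (c x y) * cnj (u x - u y) * (v x - v y)) p))"
    by (simp add: energy_def)
  also have "\<dots> = energy c v u"
    unfolding energy_def
    by (intro arg_cong2[where f = "(*)"] infsum_cong refl) (auto simp: mult_ac)
  finally show ?thesis by simp
qed

text \<open>Symmetry of \<open>c\<close> splits the edge term into \<open>?t x y + ?t y x\<close>.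
  Swapping the order of summation identifies the two double sums, which cancels the factor
  1/2.\<close>

lemma sum_by_parts:
  assumes "finite H"
  shows "(\<Sum>x\<in>H. cnj (u x) * normal_derivative c H v x)
    = 1/2 * (\<Sum>(x, y)\<in>H \<times> H. of_real (c x y) * cnj (u x - u y) * (v x - v y))"
proof -
  let ?t = "\<lambda>x y. of_real (c x y) * cnj (u x) * (v x - v y)"
  have "(\<Sum>(x, y)\<in>H \<times> H. of_real (c x y) * cnj (u x - u y) * (v x - v y))
      = (\<Sum>x\<in>H. \<Sum>y\<in>H. ?t x y + ?t y x)"
    unfolding sum.cartesian_product[symmetric]
  proof (intro sum.cong refl)
    fix x y
    show "of_real (c x y) * cnj (u x - u y) * (v x - v y) = ?t x y + ?t y x"
      using c_sym[of y x] by (simp add: algebra_simps)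
  qed
  also have "\<dots> = (\<Sum>x\<in>H. \<Sum>y\<in>H. ?t x y) + (\<Sum>x\<in>H. \<Sum>y\<in>H. ?t y x)"
    by (simp add: sum.distrib)
  also have "(\<Sum>x\<in>H. \<Sum>y\<in>H. ?t y x) = (\<Sum>x\<in>H. \<Sum>y\<in>H. ?t x y)"
    by (rule sum.swap)
  also have "(\<Sum>x\<in>H. \<Sum>y\<in>H. ?t x y) = (\<Sum>x\<in>H. cnj (u x) * normal_derivative c H v x)"
    by (simp add: normal_derivative_def sum_distrib_left mult_ac)
  finally show ?thesis by simp
qed

lemma connected_in_neighbours:
  assumes "connected_in c H"
  shows "connected_in c (H \<union> (\<Union>x\<in>H. {y. adj c x y}))"
proof -
  define K where "K = H \<union> (\<Union>x\<in>H. {y. adj c x y})"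
  let ?R = "\<lambda>A. {(p, q). p \<in> A \<and> q \<in> A \<and> adj c p q}"
  \<comment> \<open>Both directions are recorded so that two points of \<open>K\<close> can be
    joined through \<open>H\<close>: enter \<open>H\<close>, cross it, leave it.\<close>
  have near: "\<exists>z\<in>H. (x, z) \<in> (?R K)\<^sup>* \<and> (z, x) \<in> (?R K)\<^sup>*" if "x \<in> K" for x
  proof (cases "x \<in> H")
    case False
    then obtain z where "z \<in> H" "adj c z x"
      using \<open>x \<in> K\<close> by (auto simp: K_def)
    moreover from this have "adj c x z"
      by (simp add: adj_def c_sym)
    ultimately show ?thesis
      using \<open>x \<in> K\<close> by (intro bexI[of _ z]) (auto simp: K_def)
  qed auto
  have "(?R H)\<^sup>* \<subseteq> (?R K)\<^sup>*"
    by (rule rtrancl_mono) (auto simp: K_def)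
  then have "(x, y) \<in> (?R K)\<^sup>*" if "x \<in> H" "y \<in> H" for x y
    using assms that by (auto simp: connected_in_def)
  then show ?thesis
    unfolding K_def[symmetric] connected_in_def using near by (meson rtrancl_trans)
qed

end

section \<open>Locally finite networks, where the Laplacian is a finite sum\<close>

locale locally_finite_network = resistance_network c for c :: "'v \<Rightarrow> 'v \<Rightarrow> real" +
  assumes locally_finite: "locally_finite c"
begin

lemma finite_neighbours: "finite {y. adj c x y}"
  using locally_finite by (simp add: locally_finite_def)

lemma not_adj: "\<not> adj c x y \<Longrightarrow> c x y = 0"
  using c_nonneg[of x y] by (simp add: adj_def)

text \<open>Graph-distance balls around a vertex: local finiteness keeps them finite, connectedness
  of the network makes them cover it. This discharges the existence clause of
  \<open>has_exhaustion_limit\<close>.\<close>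

lemma exhaustion_exists: "\<exists>G. exhaustion c G"
proof -
  obtain b :: 'v where True by simp
  define G where "G = rec_nat {b} (\<lambda>_ H. H \<union> (\<Union>x\<in>H. {y. adj c x y}))"
  have G0: "G 0 = {b}" and GS: "G (Suc k) = G k \<union> (\<Union>x\<in>G k. {y. adj c x y})" for k
    by (simp_all add: G_def)
  have "finite (G k)" for k
    by (induction k) (auto simp: G0 GS finite_neighbours)
  moreover have "connected_in c (G k)" for k
    by (induction k) (simp add: G0 connected_in_def, simp add: GS connected_in_neighbours)
  moreover have "\<exists>k. x \<in> G k" for x
  proof -
    have "(b, x) \<in> {(p, q). p \<in> UNIV \<and> q \<in> UNIV \<and> adj c p q}\<^sup>*"
      using connected by (simp add: connected_in_def)
    then show ?thesis
    proof (induction rule: rtrancl_induct)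
      case base
      show ?case using G0 by blast
    next
      case (step y z)
      then obtain k where "y \<in> G k" by blast
      with step have "z \<in> G (Suc k)" by (auto simp: GS)
      then show ?case ..
    qed
  qed
  ultimately have "exhaustion c G"
    unfolding exhaustion_def by (auto simp: GS)
  then show ?thesis by blast
qed

text \<open>Vertices of \<open>H\<close> not adjacent to \<open>x\<close> carry zero conductance, so
  the two sums differ only by zero terms.\<close>

lemma normal_derivative_eq_laplacian:
  assumes "finite H" "{y. adj c x y} \<subseteq> H"
  shows "normal_derivative c H v x = laplacian c v x"
  unfolding normal_derivative_def laplacian_def infsum_finite[OF finite_neighbours]
  by (rule sum.mono_neutral_right) (use assms in \<open>auto simp: not_adj\<close>)

lemma laplacian_add: "laplacian c (\<lambda>x. u x + v x) x = laplacian c u x + laplacian c v x"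
  unfolding laplacian_def infsum_finite[OF finite_neighbours]
  by (simp add: sum.distrib[symmetric] algebra_simps)

lemma laplacian_scale: "laplacian c (\<lambda>x. a * u x) x = a * laplacian c u x"
  unfolding laplacian_def infsum_finite[OF finite_neighbours]
  by (simp add: sum_distrib_left algebra_simps)

lemma laplacian_diff: "laplacian c (\<lambda>x. u x - v x) x = laplacian c u x - laplacian c v x"
  using laplacian_add[of u "\<lambda>x. -1 * v x" x] by (simp add: laplacian_scale[of "-1", simplified])

section \<open>Dirac masses and their energy pairing\<close>

definition neighbourhood :: "'v \<Rightarrow> 'v set" where
  "neighbourhood x = insert x {y. adj c x y}"

lemma finite_neighbourhood: "finite (neighbourhood x)"
  by (simp add: neighbourhood_def finite_neighbours)

text \<open>An edge along which \<open>dirac x\<close> varies has \<open>x\<close> as an endpoint,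
  so both endpoints lie in the closed neighbourhood. Energies involving \<open>dirac x\<close> thus
  reduce to a finite square.\<close>

lemma dirac_edge:
  assumes "(y, z) \<notin> neighbourhood x \<times> neighbourhood x"
  shows "c y z = 0 \<or> dirac x y = dirac x z"
  using assms not_adj[of y z] not_adj[of z y] c_sym[of y z]
  by (auto simp: neighbourhood_def dirac_def)

lemma dirac_energy_space: "dirac x \<in> energy_space c"
proof -
  have "(\<lambda>(y, z). c y z * (cmod (dirac x y - dirac x z))\<^sup>2)
      summable_on neighbourhood x \<times> neighbourhood x"
    by (simp add: finite_neighbourhood)
  then show ?thesis
    unfolding energy_space_def mem_Collect_eq
    by (rule summable_on_cong_neutral[THEN iffD1, rotated -1]) (auto dest!: dirac_edge)
qed

text \<open>After localisation to the closed neighbourhood, summation by parts leaves only the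
  normal derivative at \<open>x\<close>, which is an interior vertex there.\<close>

lemma energy_dirac: "energy c (dirac x) v = laplacian c v x"
proof -
  let ?N = "neighbourhood x"
  have "energy c (dirac x) v
      = 1/2 * (\<Sum>\<^sub>\<infinity>(y, z)\<in>?N \<times> ?N. of_real (c y z) * cnj (dirac x y - dirac x z) * (v y - v z))"
    unfolding energy_def
    by (intro arg_cong2[where f = "(*)"] infsum_cong_neutral refl) (auto dest!: dirac_edge)
  also have "\<dots> = (\<Sum>y\<in>?N. cnj (dirac x y) * normal_derivative c ?N v y)"
    by (simp add: finite_neighbourhood sum_by_parts)
  also have "\<dots> = (\<Sum>y\<in>?N. if y = x then normal_derivative c ?N v y else 0)"
    by (intro sum.cong) (auto simp: dirac_def)
  also have "\<dots> = normal_derivative c ?N v x"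
    using finite_neighbourhood[of x] by (simp add: neighbourhood_def)
  also have "\<dots> = laplacian c v x"
    by (rule normal_derivative_eq_laplacian[OF finite_neighbourhood]) (auto simp: neighbourhood_def)
  finally show ?thesis .
qed

lemma dirac_Fin: "dirac x \<in> Fin c"
proof -
  have "energy_norm c (\<lambda>y. dirac x y - dirac x y) = 0"
    by (simp add: energy_norm_def energy_self case_prod_unfold)
  moreover have "dirac x \<in> cspan (range dirac)"
    by (rule cspan_base) simp
  ultimately show ?thesis
    unfolding Fin_def using dirac_energy_space[of x]
    by (auto intro!: bexI[of _ "dirac x"])
qed

section \<open>Finitely supported Laplacians on \<M>\<close>

definition finite_laplacian_space :: "('v \<Rightarrow> complex) set" where
  "finite_laplacian_space = {v \<in> energy_space c. finite {x. laplacian c v x \<noteq> 0}}"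

lemma finite_laplacian_spaceI:
  "v \<in> energy_space c \<Longrightarrow> finite A \<Longrightarrow> (\<And>x. x \<notin> A \<Longrightarrow> laplacian c v x = 0)
    \<Longrightarrow> v \<in> finite_laplacian_space"
  unfolding finite_laplacian_space_def by (auto intro: finite_subset[of _ A])

lemma finite_laplacian_space_add:
  assumes "u \<in> finite_laplacian_space" "v \<in> finite_laplacian_space"
  shows "(\<lambda>x. u x + v x) \<in> finite_laplacian_space"
  using assms
  by (intro finite_laplacian_spaceI[where A = "{x. laplacian c u x \<noteq> 0} \<union> {x. laplacian c v x \<noteq> 0}"])
     (auto simp: finite_laplacian_space_def energy_space_add laplacian_add)

lemma finite_laplacian_space_scale:
  assumes "v \<in> finite_laplacian_space"
  shows "(\<lambda>x. a * v x) \<in> finite_laplacian_space"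
  using assms
  by (intro finite_laplacian_spaceI[where A = "{x. laplacian c v x \<noteq> 0}"])
     (auto simp: finite_laplacian_space_def energy_space_scale laplacian_scale)

lemma finite_laplacian_space_cspan:
  assumes "S \<subseteq> finite_laplacian_space"
  shows "cspan S \<subseteq> finite_laplacian_space"
proof
  fix p assume "p \<in> cspan S"
  then show "p \<in> finite_laplacian_space"
  proof (induction rule: cspan_induct)
    case zero
    show ?case
      by (rule finite_laplacian_spaceI[where A = "{}"]) (auto simp: energy_space_zero laplacian_def)
  next
    case (step g h a)
    then show ?case
      using assms by (intro finite_laplacian_space_add finite_laplacian_space_scale) auto
  qed
qed

lemma kernel_finite_laplacian:
  assumes v: "is_kernel c b x v"
  shows "v \<in> finite_laplacian_space"
proof (rule finite_laplacian_spaceI[where A = "{x, b}"])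
  show "v \<in> energy_space c"
    using v by (simp add: is_kernel_def)
  fix y assume y: "y \<notin> {x, b}"
  \<comment> \<open>The reproducing property has \<open>v\<close> in the first slot,
    \<open>energy_dirac\<close> in the second; Hermitian symmetry bridges the two. The value
    \<open>dirac y x - dirac y b\<close> vanishes away from \<open>x\<close> and
    \<open>b\<close>.\<close>
  have "laplacian c v y = cnj (energy c v (dirac y))"
    using energy_cnj[of "dirac y" v] by (simp add: energy_dirac)
  also have "\<dots> = 0"
    using v y dirac_energy_space[of y] by (auto simp: is_kernel_def dirac_def)
  finally show "laplacian c v y = 0" .
qed simp

text \<open>The residual of the projection is orthogonal to every Dirac mass, hence harmonic, so
  \<open>f\<close> inherits the Laplacian of the kernel \<open>v\<close>.\<close>

lemma fin_kernel_finite_laplacian: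
  assumes "is_fin_kernel c b x f"
  shows "f \<in> finite_laplacian_space"
proof -
  obtain v where v: "is_kernel c b x v" and f: "is_projection c (Fin c) v f"
    using assms by (auto simp: is_fin_kernel_def)
  have "laplacian c f y = laplacian c v y" for y
  proof -
    have "energy c (dirac y) (\<lambda>x. v x - f x) = 0"
      using f dirac_Fin[of y] by (simp add: is_projection_def)
    then show ?thesis
      by (simp add: energy_dirac laplacian_diff)
  qed
  moreover have "f \<in> energy_space c"
    using f by (simp add: is_projection_def Fin_def)
  ultimately show ?thesis
    using kernel_finite_laplacian[OF v] by (simp add: finite_laplacian_space_def)
qed

lemma monopole_finite_laplacian: "is_monopole c x w \<Longrightarrow> w \<in> finite_laplacian_space"
  by (rule finite_laplacian_spaceI[where A = "{x}"]) (auto simp: is_monopole_def dirac_def)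

lemma \<M>_finite_laplacian: "\<M> c b \<subseteq> finite_laplacian_space"
proof -
  have "cspan (kernels c b) \<subseteq> finite_laplacian_space"
    by (intro finite_laplacian_space_cspan) (auto simp: kernels_def kernel_finite_laplacian)
  moreover have "cspan (monopole_kernels c b) \<subseteq> finite_laplacian_space"
    by (intro finite_laplacian_space_cspan)
       (auto simp: monopole_kernels_def is_minimal_monopole_def intro!: finite_laplacian_space_add
         intro: kernel_finite_laplacian fin_kernel_finite_laplacian monopole_finite_laplacian)
  ultimately show ?thesis
    unfolding \<M>_def by (auto intro!: finite_laplacian_space_add)
qed

section \<open>The Gauss-Green identity\<close>

theorem gauss_green:
  assumes u: "u \<in> energy_space c" and v: "v \<in> finite_laplacian_space"
  defines "S \<equiv> \<Sum>x\<in>{x. laplacian c v x \<noteq> 0}. cnj (u x) * laplacian c v x"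
  shows "has_vertex_sum c (\<lambda>x. cnj (u x) * laplacian c v x) S"
    and "has_boundary_sum c u v (energy c u v - S)"
proof -
  let ?A = "{x. laplacian c v x \<noteq> 0}" and ?h = "\<lambda>x. cnj (u x) * laplacian c v x"
  have A: "finite ?A" and vE: "v \<in> energy_space c"
    using v by (auto simp: finite_laplacian_space_def)
  \<comment> \<open>Used twice: with \<open>G k\<close> for the vertex sum, and with the interior of
    \<open>G k\<close> for the boundary sum.\<close>
  have sum_h: "sum ?h H = S" if "finite H" "?A \<subseteq> H" for H
    unfolding S_def by (rule sum.mono_neutral_right) (use that in auto)
  have "(\<lambda>k. sum ?h (G k)) \<longlonglongrightarrow> S" if G: "exhaustion c G" for G
  proof (rule tendsto_eventually)
    show "\<forall>\<^sub>F k in sequentially. sum ?h (G k) = S"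
      using exhaustion_eventually_superset[OF G A]
      by eventually_elim (simp add: sum_h exhaustion_finite[OF G])
  qed
  then show "has_vertex_sum c ?h S"
    using exhaustion_exists by (simp add: has_vertex_sum_def has_exhaustion_limit_def)
  let ?e = "\<lambda>(x, y). of_real (c x y) * cnj (u x - u y) * (v x - v y)"
  have "(\<lambda>k. \<Sum>x\<in>bd c (G k). cnj (u x) * normal_derivative c (G k) v x) \<longlonglongrightarrow> energy c u v - S"
    if G: "exhaustion c G" for G
  proof (rule Lim_transform_eventually)
    show "(\<lambda>k. 1/2 * sum ?e (G k \<times> G k) - S) \<longlonglongrightarrow> energy c u v - S"
      unfolding energy_def
      by (intro tendsto_intros exhaustion_tendsto_infsum[OF G energy_summable[OF u vE]])
    \<comment> \<open>Absorbing the neighbours as well keeps the support of the Laplacian off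
      \<open>bd c (G k)\<close>, so no term of \<open>S\<close> is counted in the boundary
      sum.\<close>
    have "\<forall>\<^sub>F k in sequentially. (\<Union>x\<in>?A. neighbourhood x) \<subseteq> G k"
      by (rule exhaustion_eventually_superset[OF G]) (use A finite_neighbourhood in auto)
    then show "\<forall>\<^sub>F k in sequentially. 1/2 * sum ?e (G k \<times> G k) - S
        = (\<Sum>x\<in>bd c (G k). cnj (u x) * normal_derivative c (G k) v x)"
    proof eventually_elim
      case (elim k)
      let ?H = "G k" and ?n = "\<lambda>x. cnj (u x) * normal_derivative c (G k) v x"
      have H: "finite ?H" by (rule exhaustion_finite[OF G])
      have "?A \<subseteq> ?H - bd c ?H"
        using elim by (auto simp: neighbourhood_def bd_def)
      then have "S = sum ?h (?H - bd c ?H)"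
        using H by (simp add: sum_h)
      also have "\<dots> = sum ?n (?H - bd c ?H)"
        by (intro sum.cong refl arg_cong2[where f = "(*)"] normal_derivative_eq_laplacian[symmetric] H)
           (auto simp: bd_def)
      \<comment> \<open>Interior plus boundary is all of \<open>?H\<close>, and
        \<open>sum_by_parts\<close> turns that total into the truncated energy.\<close>
      finally have "S + sum ?n (bd c ?H) = sum ?n ?H"
        using sum.subset_diff[of "bd c ?H" ?H ?n] H by (auto simp: bd_def)
      then show ?case
        using sum_by_parts[OF H, of u v] by (simp add: algebra_simps)
    qed
  qed
  then show "has_boundary_sum c u v (energy c u v - S)"
    using exhaustion_exists by (simp add: has_boundary_sum_def has_exhaustion_limit_def)
qed

end

theorem theorem3p12:
  fixes c :: "'v \<Rightarrow> 'v \<Rightarrow> real" and b :: 'v and u v :: "'v \<Rightarrow> complex"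
  assumes "resistance_network c"
    and "locally_finite c"
    and "u \<in> energy_space c"
    and "v \<in> \<M> c b"
  shows "\<exists>S B. has_vertex_sum c (\<lambda>x. cnj (u x) * laplacian c v x) S
             \<and> has_boundary_sum c u v B
             \<and> energy c u v = S + B"
proof -
  interpret locally_finite_network c
    using assms(1,2) by (simp add: locally_finite_network_def locally_finite_network_axioms_def)
  note gg = gauss_green[OF \<open>u \<in> energy_space c\<close> subsetD[OF \<M>_finite_laplacian \<open>v \<in> \<M> c b\<close>]]
  show ?thesis
    \<comment> \<open>The witness for \<open>B\<close> is the energy minus \<open>S\<close>, so the
      identity is pure arithmetic once both limits exist.\<close>
    by (rule exI, rule exI, rule conjI[OF gg(1) conjI[OF gg(2)]]) simp
qed

end
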